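(* Let $\phi$ be a finite Blaschke product of degree $q\ge2$ with $\phi(0)=0$, and assume that $\phi$ is mixing at a double exponential rate (with respect to $\mu$) with exponent $\gamma=\log q$. Then $\phi(z)=e^{i\psi}z^{q}$ for some $\psi\in[0,2\pi)$.
   Context: $\mathbb{S}^1=\{|z|=1\}$, $d\mu(z)=\frac{1}{2\pi i}\frac{dz}{z}$ is normalized Lebesgue measure on $\mathbb{S}^1$. A finite Blaschke product of degree $q$ is a map $\phi(z)=e^{i\psi}\prod_{i=1}^q\frac{z-\lambda_i}{1-\overline{\lambda_i}z}$ with $\psi\in[0,2\pi)$, $|\lambda_i|<1$. For $0<\theta<1$, $\mathcal{H}_\theta$ is the closure of the linear combinations of $z^k$, $k\in\mathbb{Z}$, with respect to $\|f\|_\theta=\sqrt{\sum_{k\in\mathbb{Z}}|f_k|^2\theta^{-2|k|}}$, where $f_k$ are the Fourier coefficients of $f$. With $\phi^n$ the $n$-fold iterate, $\mathcal{C}_{f,g}(n)=\left|\int_{\mathbb{S}^1}(f\circ\phi^n)\,\overline{g}\,d\mu-\int_{\mathbb{S}^1}f\,d\mu\int_{\mathbb{S}^1}\overline{g}\,d\mu\right|$. The map $\phi$ is mixing at a double exponential rate with exponent $\gamma>0$ if for some $0<\theta<1$ there exist $\beta>0$, $C>0$ such that $\mathcal{C}_{f,g}(n)\le Ce^{-\beta e^{\gamma n}}\|f\|_\theta\|g\|_\theta$ for all $f,g\in\mathcal{H}_\theta$ and all $n\ge1$. *)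

theory Defs
  imports "HOL-Complex_Analysis.Complex_Analysis"
begin

text \<open>
  A degree \<open>q\<close> finite Blaschke product is a rational map. Nothing is required of the HOL function
  at the poles, which all lie outside the closed unit disc.
\<close>

definition finite_blaschke_product :: "nat \<Rightarrow> (complex \<Rightarrow> complex) \<Rightarrow> bool" where
  "finite_blaschke_product q \<phi> \<longleftrightarrow>
     (\<exists>\<psi> a. 0 \<le> \<psi> \<and> \<psi> < 2 * pi \<and> (\<forall>i\<in>{1..q}. cmod (a i) < 1) \<and>
        (\<forall>z. (\<forall>i\<in>{1..q}. 1 - cnj (a i) * z \<noteq> 0) \<longrightarrow>
             \<phi> z = cis \<psi> * (\<Prod>i=1..q. (z - a i) / (1 - cnj (a i) * z))))"

text \<open>Integration against \<open>dz / (2 \<pi> \<i> z)\<close>, the normalized Lebesgue measure of the unit circle.\<close>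

definition circle_integral :: "(complex \<Rightarrow> complex) \<Rightarrow> complex" where
  "circle_integral f =
     1 / (2 * of_real pi * \<i>) * contour_integral (circlepath 0 1) (\<lambda>z. f z / z)"

lemma circle_integral_eq_integral:
  "circle_integral f = integral {0..1} (\<lambda>t. f (cis (2 * pi * t)))"
proof -
  have cp: "circlepath 0 1 t = cis (2 * pi * t)" for t
    by (simp add: circlepath cis_conv_exp mult_ac)
  have "contour_integral (circlepath 0 1) (\<lambda>z. f z / z) =
        integral {0..1} (\<lambda>t. (2 * of_real pi * \<i>) * f (cis (2 * pi * t)))"
    unfolding contour_integral_integral
    by (rule integral_cong)
       (simp add: vector_derivative_circlepath cp cis_conv_exp mult_ac)
  then show ?thesis
    by (simp add: circle_integral_def)
qed

definition fourier_coeff :: "(complex \<Rightarrow> complex) \<Rightarrow> int \<Rightarrow> complex" where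
  "fourier_coeff f k = circle_integral (\<lambda>z. f z * cnj (z powi k))"

definition norm_theta :: "real \<Rightarrow> (complex \<Rightarrow> complex) \<Rightarrow> real" where
  "norm_theta \<theta> f =
     sqrt (\<Sum>\<^sub>\<infinity>k\<in>UNIV. (cmod (fourier_coeff f k))\<^sup>2 * \<theta> powi (- 2 * \<bar>k\<bar>))"

definition finite_norm_theta :: "real \<Rightarrow> (complex \<Rightarrow> complex) \<Rightarrow> bool" where
  "finite_norm_theta \<theta> f \<longleftrightarrow>
     (\<lambda>k. (cmod (fourier_coeff f k))\<^sup>2 * \<theta> powi (- 2 * \<bar>k\<bar>)) summable_on UNIV"

definition laurent_polynomials :: "(complex \<Rightarrow> complex) set" where
  "laurent_polynomials = {\<lambda>z. \<Sum>k\<in>K. a k * z powi k | (K :: int set) a. finite K}"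

text \<open>
  The closure is taken inside the continuous functions on the unit circle. For \<open>0 < \<theta> < 1\<close> the
  norm dominates a multiple of the supremum norm, so this closure is complete, i.e. it is the
  completion of the Laurent polynomials, each element being given by its unique continuous
  representative. Only the values on the circle are relevant. The condition
  \<^const>\<open>finite_norm_theta\<close> is needed since \<^const>\<open>infsum\<close> is \<open>0\<close> on divergent sums.
\<close>

definition H_theta :: "real \<Rightarrow> (complex \<Rightarrow> complex) set" where
  "H_theta \<theta> = {f. continuous_on (sphere 0 1) f \<and>
     (\<forall>\<epsilon>>0. \<exists>p\<in>laurent_polynomials.
        finite_norm_theta \<theta> (\<lambda>z. f z - p z) \<and> norm_theta \<theta> (\<lambda>z. f z - p z) < \<epsilon>)}"

definition correlation ::
  "(complex \<Rightarrow> complex) \<Rightarrow> (complex \<Rightarrow> complex) \<Rightarrow> (complex \<Rightarrow> complex) \<Rightarrow> nat \<Rightarrow> real" where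
  "correlation \<phi> f g n =
     cmod (circle_integral (\<lambda>z. f ((\<phi> ^^ n) z) * cnj (g z)) -
           circle_integral f * circle_integral (\<lambda>z. cnj (g z)))"

definition double_exp_mixing :: "(complex \<Rightarrow> complex) \<Rightarrow> real \<Rightarrow> bool" where
  "double_exp_mixing \<phi> \<gamma> \<longleftrightarrow> \<gamma> > 0 \<and>
     (\<exists>\<theta>. 0 < \<theta> \<and> \<theta> < 1 \<and>
        (\<exists>\<beta>>0. \<exists>C>0. \<forall>f\<in>H_theta \<theta>. \<forall>g\<in>H_theta \<theta>. \<forall>n\<ge>1.
           correlation \<phi> f g n
             \<le> C * exp (- \<beta> * exp (\<gamma> * real n)) * norm_theta \<theta> f * norm_theta \<theta> g))"

end

theory Submission
  imports Defs
begin

text \<open>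
  Write \<open>\<phi> z = z ^ m * h z\<close>, where \<open>m\<close> is the order of the fixed point \<open>0\<close> and \<open>h\<close> is a Blaschke
  product of degree \<open>q - m\<close> with \<open>h 0 \<noteq> 0\<close>. Composing, the \<open>n\<close>-th iterate is
  \<open>z ^ (m ^ n) * H z\<close> with \<open>H 0 = h 0 ^ (1 + m + \<dots> + m ^ (n - 1))\<close>
  (\<open>funpow_leading_coeff\<close>), so its first Taylor coefficient that does not vanish
  has size \<open>\<bar>h 0\<bar> ^ (1 + m + \<dots> + m ^ (n - 1))\<close>. Its logarithm is at least a constant times
  \<open>- n * m ^ n\<close>.

  On the other hand, this Taylor coefficient is the correlation of \<open>f z = z\<close> and
  \<open>g z = z ^ (m ^ n)\<close> (\<open>correlation_id_power\<close>), whose norms are \<open>1 / \<theta>\<close> and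
  \<open>(1 / \<theta>) ^ (m ^ n)\<close> (\<open>norm_theta_power\<close>). Mixing with exponent \<open>ln q\<close> makes it at most a constant
  times \<open>exp (- \<beta> * q ^ n) * (1 / \<theta>) ^ (m ^ n)\<close>. If \<open>m < q\<close>, then \<open>q ^ n\<close> outgrows both \<open>m ^ n\<close>
  and \<open>n * m ^ n\<close>, and the two estimates contradict each other
  (\<open>no_double_exponential_bound\<close>). Hence \<open>m = q\<close>, all zeros of \<open>\<phi>\<close> are at \<open>0\<close>, and \<open>\<phi>\<close> is
  a rotated power.
\<close>

section \<open>Integrals over the unit circle\<close>

lemma circle_integral_cong:
  assumes "\<And>z. cmod z = 1 \<Longrightarrow> f z = g z"
  shows "circle_integral f = circle_integral g"
  unfolding circle_integral_eq_integral by (rule integral_cong) (simp add: assms)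

lemma circle_integral_cnj: "circle_integral (\<lambda>z. cnj (f z)) = cnj (circle_integral f)"
  unfolding circle_integral_eq_integral by (rule integral_cnj [symmetric])

lemma circle_integral_mean_value:
  assumes "continuous_on (cball 0 1) f" "f holomorphic_on ball 0 1"
  shows "circle_integral f = f 0"
proof -
  have "((\<lambda>u. f u / (u - 0)) has_contour_integral (2 * of_real pi * \<i>) * f 0) (circlepath 0 1)"
    by (rule Cauchy_integral_circlepath) (use assms in auto)
  then show ?thesis
    by (simp add: circle_integral_def contour_integral_unique)
qed

lemma circle_integral_power: "circle_integral (\<lambda>z. z ^ k) = 0 ^ k"
  by (rule circle_integral_mean_value) (auto intro!: continuous_intros holomorphic_intros)

lemma power_mult_cnj_unit:
  assumes "cmod z = 1"
  shows "z ^ k * cnj (z ^ k) = 1"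
  by (metis assms complex_norm_square norm_power of_real_1 power_one)

lemma fourier_coeff_power: "fourier_coeff (\<lambda>z. z ^ k) j = (if j = int k then 1 else 0)"
proof (cases "j \<le> int k")
  case True
  have eq: "z ^ k * cnj (z powi j) = z ^ nat (int k - j)" if "cmod z = 1" for z
  proof -
    have "z \<noteq> 0" using that by auto
    have "z ^ k = z powi (int k - j) * z powi j"
      using \<open>z \<noteq> 0\<close> by (simp flip: power_int_add)
    moreover have "z powi j * cnj (z powi j) = 1"
      by (metis complex_norm_square norm_power_int of_real_1 power_int_1_left power_one that)
    moreover have "z powi (int k - j) = z ^ nat (int k - j)"
      using True by (simp add: power_int_def)
    ultimately show ?thesis
      by (simp add: mult.assoc)
  qed
  have "fourier_coeff (\<lambda>z. z ^ k) j = 0 ^ nat (int k - j)"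
    unfolding fourier_coeff_def circle_integral_power [symmetric]
    by (rule circle_integral_cong) (rule eq)
  then show ?thesis using True by (auto simp: power_0_left)
next
  case False
  \<comment> \<open>The integrand agrees on the circle with a negative power of \<open>z\<close>, which has a pole at \<open>0\<close>; its
     conjugate agrees there with a polynomial, to which the mean value property applies.\<close>
  have eq: "z ^ k * cnj (z powi j) = cnj (z ^ nat (j - int k))" if "cmod z = 1" for z
  proof -
    have "z powi j = z ^ nat (j - int k) * z ^ k"
      using False by (simp add: power_int_def nat_diff_distrib flip: power_add)
    then show ?thesis
      using power_mult_cnj_unit [OF that, of k] by (simp add: ac_simps)
  qed
  have "fourier_coeff (\<lambda>z. z ^ k) j = cnj (0 ^ nat (j - int k))"
    unfolding fourier_coeff_def circle_integral_power [symmetric] circle_integral_cnj [symmetric]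
    by (rule circle_integral_cong) (rule eq)
  then show ?thesis using False by (auto simp: power_0_left)
qed

lemma norm_theta_power:
  assumes "0 < \<theta>"
  shows "norm_theta \<theta> (\<lambda>z. z ^ k) = (1 / \<theta>) ^ k"
proof -
  have "(\<Sum>\<^sub>\<infinity>j\<in>UNIV. (cmod (fourier_coeff (\<lambda>z. z ^ k) j))\<^sup>2 * \<theta> powi (- 2 * \<bar>j\<bar>)) =
        (\<Sum>\<^sub>\<infinity>j\<in>{int k}. \<theta> powi (- 2 * \<bar>j\<bar>))"
    by (rule infsum_cong_neutral) (auto simp: fourier_coeff_power)
  also have "\<dots> = \<theta> powi (- 2 * int k)"
    by simp
  also have "\<dots> = ((1 / \<theta>) ^ k)\<^sup>2"
    by (simp add: power_int_def power_divide inverse_eq_divide nat_mult_distrib flip: power_mult)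
       (simp add: mult.commute)
  finally show ?thesis
    using assms by (simp add: norm_theta_def)
qed

lemma power_in_H_theta: "(\<lambda>z. z ^ k) \<in> H_theta \<theta>"
proof -
  have "(\<lambda>z. z ^ k) \<in> laurent_polynomials"
    unfolding laurent_polynomials_def
    by (intro CollectI exI [of _ "{int k}"] exI [of _ "\<lambda>_. 1"]) auto
  moreover have "finite_norm_theta \<theta> (\<lambda>z. z ^ k - z ^ k)" "norm_theta \<theta> (\<lambda>z. z ^ k - z ^ k) = 0"
    by (simp_all add: finite_norm_theta_def norm_theta_def fourier_coeff_def circle_integral_def)
  ultimately show ?thesis
    unfolding H_theta_def
    by (intro CollectI conjI allI impI bexI [of _ "\<lambda>z. z ^ k"] continuous_intros) simp_all
qed

section \<open>Iterates near the fixed point\<close>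

text \<open>
  In \<open>\<phi> ^^ Suc n = (\<phi> ^^ n) \<circ> \<phi>\<close>, the factorization of \<open>\<phi> ^^ n\<close> turns into
  \<open>\<phi> z ^ (m ^ n) * H (\<phi> z)\<close>, and each factor of \<open>\<phi> z\<close> contributes \<open>z ^ m * h z\<close>. Since \<open>\<phi>\<close> fixes
  \<open>0\<close>, evaluating the cofactors at \<open>0\<close> multiplies \<open>H 0\<close> by \<open>h 0 ^ (m ^ n)\<close>.
\<close>

lemma funpow_leading_coeff:
  fixes \<phi> h :: "complex \<Rightarrow> complex"
  assumes h: "continuous_on (cball 0 1) h" "h holomorphic_on ball 0 1"
    and \<phi>: "\<And>z. cmod z \<le> 1 \<Longrightarrow> \<phi> z = z ^ m * h z"
    and contr: "\<And>z. cmod z \<le> 1 \<Longrightarrow> cmod (\<phi> z) \<le> cmod z"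
  shows "\<exists>H. continuous_on (cball 0 1) H \<and> H holomorphic_on ball 0 1 \<and>
             (\<forall>z. cmod z \<le> 1 \<longrightarrow> (\<phi> ^^ n) z = z ^ (m ^ n) * H z) \<and>
             H 0 = h 0 ^ (\<Sum>i<n. m ^ i)"
proof (induction n)
  case 0
  show ?case by (rule exI [of _ "\<lambda>_. 1"]) auto
next
  case (Suc n)
  then obtain H where H: "continuous_on (cball 0 1) H" "H holomorphic_on ball 0 1"
      "\<And>z. cmod z \<le> 1 \<Longrightarrow> (\<phi> ^^ n) z = z ^ (m ^ n) * H z"
      "H 0 = h 0 ^ (\<Sum>i<n. m ^ i)"
    by blast
  have "continuous_on (cball 0 1) (\<lambda>z. z ^ m * h z)"
    by (intro continuous_intros h)
  then have \<phi>_cont: "continuous_on (cball 0 1) \<phi>"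
    by (rule continuous_on_eq) (simp add: \<phi>)
  have "(\<lambda>z. z ^ m * h z) holomorphic_on ball 0 1"
    by (intro holomorphic_intros h)
  then have \<phi>_hol: "\<phi> holomorphic_on ball 0 1"
    by (rule holomorphic_transform) (simp add: \<phi>)
  have "cmod (\<phi> z) \<le> 1" if "cmod z \<le> 1" for z
    using contr [OF that] that by linarith
  moreover have "cmod (\<phi> z) < 1" if "cmod z < 1" for z
    using contr [of z] that by linarith
  ultimately have maps: "\<phi> ` cball 0 1 \<subseteq> cball 0 1" "\<phi> ` ball 0 1 \<subseteq> ball 0 1"
    by auto
  have "\<phi> 0 = 0" using contr [of 0] by simp
  define H' where "H' = (\<lambda>z. h z ^ (m ^ n) * H (\<phi> z))"
  have "continuous_on (cball 0 1) H'"
    unfolding H'_def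
    by (intro continuous_intros h continuous_on_compose2 [OF H(1) \<phi>_cont maps(1)])
  moreover have "H' holomorphic_on ball 0 1"
    unfolding H'_def
    by (intro holomorphic_intros h holomorphic_on_compose_gen [OF \<phi>_hol H(2) maps(2), unfolded o_def])
  moreover have "(\<phi> ^^ Suc n) z = z ^ (m ^ Suc n) * H' z" if "cmod z \<le> 1" for z
  proof -
    have "(\<phi> ^^ Suc n) z = (\<phi> ^^ n) (\<phi> z)"
      by (simp only: funpow_Suc_right o_def)
    also have "\<dots> = \<phi> z ^ (m ^ n) * H (\<phi> z)"
      using contr [OF that] that by (intro H(3)) auto
    also have "\<dots> = z ^ (m ^ Suc n) * H' z"
      unfolding H'_def \<phi> [OF that] by (simp add: power_mult_distrib power_mult)
    finally show ?thesis .
  qed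
  moreover have "H' 0 = h 0 ^ (\<Sum>i<Suc n. m ^ i)"
    by (simp add: H'_def \<open>\<phi> 0 = 0\<close> H(4) power_add)
  ultimately show ?case by blast
qed

text \<open>
  On the circle \<open>cnj (z ^ k)\<close> cancels the factor \<open>z ^ k\<close>, and the mean of what is left is \<open>H 0\<close>. The
  product of the two separate integrals vanishes because \<open>z\<close> has mean \<open>0\<close>.
\<close>

lemma correlation_id_power:
  assumes H: "continuous_on (cball 0 1) H" "H holomorphic_on ball 0 1"
    and eq: "\<And>z. cmod z = 1 \<Longrightarrow> (\<phi> ^^ n) z = z ^ k * H z"
  shows "correlation \<phi> (\<lambda>z. z ^ 1) (\<lambda>z. z ^ k) n = cmod (H 0)"
proof -
  have "circle_integral (\<lambda>z. ((\<phi> ^^ n) z) ^ 1 * cnj (z ^ k)) = circle_integral H"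
  proof (rule circle_integral_cong)
    fix z :: complex assume z: "cmod z = 1"
    have "z ^ k * H z * cnj (z ^ k) = (z ^ k * cnj (z ^ k)) * H z"
      by (simp only: ac_simps)
    then show "((\<phi> ^^ n) z) ^ 1 * cnj (z ^ k) = H z"
      by (simp only: eq [OF z] power_mult_cnj_unit [OF z] power_one_right mult_1)
  qed
  also have "\<dots> = H 0"
    by (rule circle_integral_mean_value [OF H])
  finally show ?thesis
    unfolding correlation_def circle_integral_power by simp
qed

section \<open>Blaschke factors\<close>

lemma blaschke_denominator_nonzero:
  fixes a z :: complex
  assumes "cmod a < 1" "cmod z \<le> 1"
  shows "1 - cnj a * z \<noteq> 0"
proof
  assume "1 - cnj a * z = 0"
  then have "cmod (cnj a * z) = 1" by simp
  moreover have "cmod (cnj a * z) \<le> cmod a"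
    using assms by (simp add: norm_mult mult_left_le)
  ultimately show False using assms by simp
qed

text \<open>
  The bound rests on the identity
  \<open>\<bar>1 - cnj a * z\<bar>\<^sup>2 - \<bar>z - a\<bar>\<^sup>2 = (1 - \<bar>a\<bar>\<^sup>2) * (1 - \<bar>z\<bar>\<^sup>2)\<close>.
\<close>

lemma blaschke_factor_le_1:
  fixes a z :: complex
  assumes "cmod a < 1" "cmod z \<le> 1"
  shows "cmod ((z - a) / (1 - cnj a * z)) \<le> 1"
proof -
  have "(cmod (1 - cnj a * z))\<^sup>2 - (cmod (z - a))\<^sup>2 = (1 - (cmod a)\<^sup>2) * (1 - (cmod z)\<^sup>2)"
    unfolding cmod_power2 by (simp add: power2_eq_square algebra_simps)
  also have "\<dots> \<ge> 0"
    using assms by (intro mult_nonneg_nonneg) (auto simp: power_le_one)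
  finally have "cmod (z - a) \<le> cmod (1 - cnj a * z)"
    by (simp flip: abs_le_square_iff)
  then show ?thesis
    by (simp add: norm_divide divide_le_eq_1)
qed

section \<open>Rigidity\<close>

text \<open>
  After taking logarithms and dividing by \<open>q ^ n\<close>, the constant \<open>\<beta>\<close> would be bounded by a
  linear combination of \<open>1 / q ^ n\<close>, \<open>(m / q) ^ n\<close> and \<open>n * (m / q) ^ n\<close>, all of which tend to \<open>0\<close>.
\<close>

lemma no_double_exponential_bound:
  fixes c \<beta> C D :: real and m q :: nat
  assumes "1 \<le> m" "m < q" "0 < c" "0 < \<beta>" "0 < C" "0 < D"
    and bound: "\<And>n. n \<ge> 1 \<Longrightarrow>
      c ^ (\<Sum>i<n. m ^ i) \<le> C * exp (- \<beta> * real q ^ n) * D ^ (m ^ n)"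
  shows False
proof -
  define p where "p = real m / real q"
  have p: "\<bar>p\<bar> < 1" using assms by (simp add: p_def)
  have "2 \<le> q" using assms by simp
  have le: "\<beta> \<le> \<bar>ln C\<bar> * (1 / real q) ^ n + \<bar>ln D\<bar> * p ^ n + \<bar>ln c\<bar> * (real n * p ^ n)"
    if "n \<ge> 1" for n
  proof -
    define S where "S = (\<Sum>i<n. m ^ i)"
    have "S \<le> (\<Sum>i<n. m ^ n)"
      unfolding S_def using assms by (intro sum_mono power_increasing) auto
    then have "real S \<le> real (n * m ^ n)"
      by (intro of_nat_mono) simp
    then have S: "real S \<le> real n * real m ^ n" by simp
    have "ln (c ^ S) \<le> ln (C * exp (- \<beta> * real q ^ n) * D ^ (m ^ n))"
      using bound [OF that] assms unfolding S_def by (subst ln_le_cancel_iff) auto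
    then have "real S * ln c \<le> ln C - \<beta> * real q ^ n + real m ^ n * ln D"
      using assms by (simp add: ln_mult ln_realpow)
    moreover have "- (real S * ln c) \<le> real n * real m ^ n * \<bar>ln c\<bar>"
    proof -
      have "- (real S * ln c) \<le> real S * \<bar>ln c\<bar>"
        using mult_left_mono [OF abs_ge_minus_self, of "real S" "ln c"] by simp
      also have "\<dots> \<le> real n * real m ^ n * \<bar>ln c\<bar>"
        by (rule mult_right_mono [OF S abs_ge_zero])
      finally show ?thesis .
    qed
    moreover have "real m ^ n * ln D \<le> real m ^ n * \<bar>ln D\<bar>"
      by (intro mult_left_mono) auto
    ultimately have "\<beta> * real q ^ n \<le> \<bar>ln C\<bar> + real m ^ n * \<bar>ln D\<bar> + real n * real m ^ n * \<bar>ln c\<bar>"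
      by linarith
    then have "\<beta> \<le> (\<bar>ln C\<bar> + real m ^ n * \<bar>ln D\<bar> + real n * real m ^ n * \<bar>ln c\<bar>) / real q ^ n"
      using \<open>2 \<le> q\<close> by (simp add: pos_le_divide_eq)
    then show ?thesis
      by (simp add: p_def power_divide add_divide_distrib ac_simps)
  qed
  have "(\<lambda>n. \<bar>ln C\<bar> * (1 / real q) ^ n + \<bar>ln D\<bar> * p ^ n + \<bar>ln c\<bar> * (real n * p ^ n))
          \<longlonglongrightarrow> \<bar>ln C\<bar> * 0 + \<bar>ln D\<bar> * 0 + \<bar>ln c\<bar> * 0"
    using p \<open>2 \<le> q\<close>
    by (intro tendsto_intros LIMSEQ_power_zero powser_times_n_limit_0) auto
  then have "\<beta> \<le> \<bar>ln C\<bar> * 0 + \<bar>ln D\<bar> * 0 + \<bar>ln c\<bar> * 0"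
    by (rule LIMSEQ_le_const) (use le in blast)
  then show False using \<open>0 < \<beta>\<close> by simp
qed

theorem corollary5p2:
  fixes \<phi> :: "complex \<Rightarrow> complex" and q :: nat
  assumes "q \<ge> 2"
    and "finite_blaschke_product q \<phi>"
    and "\<phi> 0 = 0"
    and "double_exp_mixing \<phi> (ln (real q))"
  shows "\<exists>\<psi>. 0 \<le> \<psi> \<and> \<psi> < 2 * pi \<and> (\<forall>z. \<phi> z = cis \<psi> * z ^ q)"
proof -
  obtain \<psi> a where \<psi>: "0 \<le> \<psi>" "\<psi> < 2 * pi"
    and a: "\<And>i. i \<in> {1..q} \<Longrightarrow> cmod (a i) < 1"
    and \<phi>: "\<And>z. (\<And>i. i \<in> {1..q} \<Longrightarrow> 1 - cnj (a i) * z \<noteq> 0) \<Longrightarrow>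
             \<phi> z = cis \<psi> * (\<Prod>i=1..q. (z - a i) / (1 - cnj (a i) * z))"
    using assms(2) unfolding finite_blaschke_product_def by blast
  obtain \<theta> \<beta> C where \<theta>: "0 < \<theta>" and "0 < \<beta>" "0 < C"
    and mixing: "\<And>f g n. \<lbrakk>f \<in> H_theta \<theta>; g \<in> H_theta \<theta>; n \<ge> 1\<rbrakk> \<Longrightarrow>
      correlation \<phi> f g n
        \<le> C * exp (- \<beta> * exp (ln (real q) * real n)) * norm_theta \<theta> f * norm_theta \<theta> g"
    using assms(4) unfolding double_exp_mixing_def by blast
  define Z where "Z = {i \<in> {1..q}. a i = 0}"
  define N where "N = {i \<in> {1..q}. a i \<noteq> 0}"
  define m where "m = card Z"
  define h where "h = (\<lambda>z. cis \<psi> * (\<Prod>i\<in>N. (z - a i) / (1 - cnj (a i) * z)))"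
  have split: "{1..q} = Z \<union> N" "Z \<inter> N = {}" "finite Z" "finite N"
    by (auto simp: Z_def N_def)
  have N: "cmod (a i) < 1" if "i \<in> N" for i
    using a that by (auto simp: N_def)
  have factor: "\<phi> z = z ^ m * h z" if "cmod z \<le> 1" for z
  proof -
    have "\<phi> z = cis \<psi> * (\<Prod>i=1..q. (z - a i) / (1 - cnj (a i) * z))"
      by (intro \<phi> blaschke_denominator_nonzero a that)
    also have "\<dots> = cis \<psi> * ((\<Prod>i\<in>Z. (z - a i) / (1 - cnj (a i) * z)) *
                              (\<Prod>i\<in>N. (z - a i) / (1 - cnj (a i) * z)))"
      unfolding split(1) using split by (subst prod.union_disjoint) auto
    also have "(\<Prod>i\<in>Z. (z - a i) / (1 - cnj (a i) * z)) = (\<Prod>i\<in>Z. z)"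
      by (rule prod.cong) (auto simp: Z_def)
    finally show ?thesis by (simp add: m_def h_def)
  qed
  have "h 0 \<noteq> 0"
    using split by (auto simp: h_def N_def)
  then have "1 \<le> m"
    using factor [of 0] assms(3) by (cases m) auto
  have h_cont: "continuous_on (cball 0 1) h"
    unfolding h_def
    by (intro continuous_intros ballI) (rule blaschke_denominator_nonzero [OF N], auto)
  have h_hol: "h holomorphic_on ball 0 1"
    unfolding h_def
    by (intro holomorphic_intros) (rule blaschke_denominator_nonzero [OF N], auto)
  have h_le: "cmod (h z) \<le> 1" if "cmod z \<le> 1" for z
    unfolding h_def norm_mult prod_norm [symmetric]
    using blaschke_factor_le_1 [OF N that] by (simp add: prod_le_1)
  have contr: "cmod (\<phi> z) \<le> cmod z" if "cmod z \<le> 1" for z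
  proof -
    have "cmod (\<phi> z) = cmod z ^ m * cmod (h z)"
      by (simp add: factor [OF that] norm_mult norm_power)
    also have "\<dots> \<le> cmod z ^ m"
      using h_le [OF that] by (simp add: mult_left_le)
    also have "\<dots> \<le> cmod z ^ 1"
      using that \<open>1 \<le> m\<close> by (intro power_decreasing) auto
    finally show ?thesis by simp
  qed
  have bound: "cmod (h 0) ^ (\<Sum>i<n. m ^ i)
      \<le> (C * (1 / \<theta>)) * exp (- \<beta> * real q ^ n) * (1 / \<theta>) ^ (m ^ n)" if "n \<ge> 1" for n
  proof -
    obtain H where H: "continuous_on (cball 0 1) H" "H holomorphic_on ball 0 1"
        "\<And>z. cmod z \<le> 1 \<Longrightarrow> (\<phi> ^^ n) z = z ^ (m ^ n) * H z"
        "H 0 = h 0 ^ (\<Sum>i<n. m ^ i)"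
      using funpow_leading_coeff [OF h_cont h_hol factor contr] by blast
    have "cmod (h 0) ^ (\<Sum>i<n. m ^ i) = correlation \<phi> (\<lambda>z. z ^ 1) (\<lambda>z. z ^ (m ^ n)) n"
      using H by (subst correlation_id_power [of H]) (auto simp: norm_power)
    also have "\<dots> \<le> C * exp (- \<beta> * exp (ln (real q) * real n)) *
        norm_theta \<theta> (\<lambda>z. z ^ 1) * norm_theta \<theta> (\<lambda>z. z ^ (m ^ n))"
      by (intro mixing power_in_H_theta that)
    also have "exp (ln (real q) * real n) = real q ^ n"
      using assms(1) by (simp add: mult.commute exp_of_nat_mult)
    finally show ?thesis
      unfolding norm_theta_power [OF \<theta>] by (simp add: ac_simps)
  qed
  have "\<not> m < q"
    using no_double_exponential_bound [of m q "cmod (h 0)" \<beta> "C * (1 / \<theta>)" "1 / \<theta>"]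
      bound \<open>1 \<le> m\<close> \<open>h 0 \<noteq> 0\<close> \<open>0 < \<beta>\<close> \<open>0 < C\<close> \<theta> by auto
  then have "card {1..q} \<le> card Z"
    by (simp add: m_def)
  then have "Z = {1..q}"
    by (intro card_seteq) (auto simp: Z_def)
  then have "a i = 0" if "i \<in> {1..q}" for i
    using that unfolding Z_def by blast
  \<comment> \<open>All denominators are now \<open>1\<close>, so the product formula is valid on the whole plane.\<close>
  then have "\<phi> z = cis \<psi> * z ^ q" for z
    by (subst \<phi>) auto
  then show ?thesis using \<psi> by blast
qed

end
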